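(* Let $\mathbf{Z} \subset \mathbf{T}\times\mathbf{U}\times\mathbf{X} \subset \mathbb{R}^{1+m+n}$ be compact, let $r$ be a fixed relaxation order, and let $\mu$ be a finite positive Borel measure supported on $\mathbf{Z}$ with moments $y_\alpha = \int_{\mathbf{Z}} z^\alpha \, \mu(dz)$ for $\alpha \in \mathbb{N}^{1+m+n}_{2r}$. For each $\varepsilon > 0$ let $\mathbf{Z}_\varepsilon \subset \mathbf{Z}$ be a mesh of resolution $\varepsilon$, and consider the linear program $$\lambda_\varepsilon^* = \min_{\tilde\mu,\,\lambda} \; \lambda \quad \text{s.t.} \quad \Big| y_\alpha - \int z^\alpha \, \tilde\mu(dz) \Big| \le \lambda \ \text{ for all } \alpha \in \mathbb{N}^{1+m+n}_{2r}, \qquad \tilde\mu \in \mathcal{M}^+(\mathbf{Z}_\varepsilon).$$ Then, as the mesh is refined, the moments of the approximate atomic measure $\tilde\mu$ converge to those of $\mu$, that is, $$\lim_{\varepsilon \to 0} \lambda_\varepsilon^* = 0.$$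
   Context: $\mathbf{T} = [t_i,t_f] \subset \mathbb{R}$ is a compact interval, and $\mathbf{U} \subset \mathbb{R}^m$, $\mathbf{X}\subset\mathbb{R}^n$ are compact sets. For a compact set $K$ of a Euclidean space, $\mathcal{M}^+(K)$ denotes the set of finite positive Borel measures supported on $K$. For $q, d \in \mathbb{N}$, $\mathbb{N}^q_d = \{\alpha \in \mathbb{N}^q : \sum_{i=1}^q \alpha_i \le d\}$ (with $0 \in \mathbb{N}$), and for $z \in \mathbb{R}^q$, $z^\alpha = \prod_{i=1}^q z_i^{\alpha_i}$. A mesh of resolution $\varepsilon$ of $\mathbf{Z}$ is a finite subset $\mathbf{Z}_\varepsilon \subset \mathbf{Z}$ such that for every $z \in \mathbf{Z}$ there exists $z_i \in \mathbf{Z}_\varepsilon$ with $|z_i - z| \le \varepsilon$; such a mesh exists for every $\varepsilon>0$ by compactness of $\mathbf{Z}$. Measures in $\mathcal{M}^+(\mathbf{Z}_\varepsilon)$ are thus nonnegative combinations of Dirac measures at the points of $\mathbf{Z}_\varepsilon$. *)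

theory Defs
  imports "HOL-Analysis.Analysis"
begin

text \<open>
  Coordinates of a point \<open>z\<close> of a Euclidean space of dimension \<open>q\<close> are its inner products with
  the \<open>q\<close> elements of \<open>Basis\<close>, so an element of \<open>\<nat>\<^sup>q\<close> is a function on \<open>Basis\<close>, normalised to be
  \<open>undefined\<close> elsewhere.  On \<open>real \<times> (real ^ 'm) \<times> (real ^ 'n)\<close> the norm of the product instance is
  the Euclidean norm of dimension \<open>1 + CARD('m) + CARD('n)\<close>.
\<close>

definition multi_indices :: "nat \<Rightarrow> ('a::euclidean_space \<Rightarrow> nat) set" where
  "multi_indices d = {\<alpha> \<in> Basis \<rightarrow>\<^sub>E UNIV. (\<Sum>b\<in>Basis. \<alpha> b) \<le> d}"

definition monomial :: "('a::euclidean_space \<Rightarrow> nat) \<Rightarrow> 'a \<Rightarrow> real" where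
  "monomial \<alpha> z = (\<Prod>b\<in>Basis. (z \<bullet> b) ^ \<alpha> b)"

text \<open>
  Measures on \<open>K\<close> are represented as Borel measures on the whole space that vanish outside \<open>K\<close>;
  for closed \<open>K\<close> this says that the topological support lies in \<open>K\<close>.
\<close>

definition finite_borel_measures_on :: "'a::euclidean_space set \<Rightarrow> 'a measure set" where
  "finite_borel_measures_on K =
     {\<mu>. sets \<mu> = sets borel \<and> finite_measure \<mu> \<and> emeasure \<mu> (- K) = 0}"

definition is_mesh :: "'a::euclidean_space set \<Rightarrow> real \<Rightarrow> 'a set \<Rightarrow> bool" where
  "is_mesh Z \<epsilon> Z' \<longleftrightarrow> finite Z' \<and> Z' \<subseteq> Z \<and> (\<forall>z\<in>Z. \<exists>z'\<in>Z'. norm (z' - z) \<le> \<epsilon>)"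

definition lp_feasible ::
  "(('a::euclidean_space \<Rightarrow> nat) \<Rightarrow> real) \<Rightarrow> nat \<Rightarrow> 'a set \<Rightarrow> 'a measure \<times> real \<Rightarrow> bool" where
  "lp_feasible y d K = (\<lambda>(\<nu>, l). \<nu> \<in> finite_borel_measures_on K \<and>
     (\<forall>\<alpha>\<in>multi_indices d. \<bar>y \<alpha> - (LINT z|\<nu>. monomial \<alpha> z)\<bar> \<le> l))"

text \<open>\<open>LEAST\<close> is a genuine minimum: it is a specified value only if the infimum is attained.\<close>

definition lp_value ::
  "(('a::euclidean_space \<Rightarrow> nat) \<Rightarrow> real) \<Rightarrow> nat \<Rightarrow> 'a set \<Rightarrow> real" where
  "lp_value y d K = (LEAST l. \<exists>\<nu>. lp_feasible y d K (\<nu>, l))"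

end

theory Submission
  imports Defs
begin

text \<open>
  A finite measure on a finite set is a vector of nonnegative weights.  The constraint for
  \<open>\<alpha> = 0\<close> bounds the total weight, so the linear program minimises over a compact set and its
  value is attained.  To bound the value, spread \<open>\<mu>\<close> over the mesh by a partition of unity whose
  member at \<open>k\<close> lives in the ball of radius \<open>2 * \<epsilon>\<close> around \<open>k\<close>: this changes the moment of order
  \<open>\<alpha>\<close> by at most the total mass of \<open>\<mu>\<close> times the oscillation of the monomial at scale \<open>2 * \<epsilon>\<close>,
  which tends to zero since monomials are uniformly continuous on the compact set \<open>Z\<close>.
\<close>

section \<open>Multi-indices and monomials\<close>

lemma finite_multi_indices: "finite (multi_indices d :: ('a::euclidean_space \<Rightarrow> nat) set)"
proof (rule finite_subset)
  show "multi_indices d \<subseteq> (Basis :: 'a set) \<rightarrow>\<^sub>E {..d}"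
  proof
    fix \<alpha> :: "'a \<Rightarrow> nat"
    assume \<alpha>: "\<alpha> \<in> multi_indices d"
    have "\<alpha> b \<le> d" if "b \<in> Basis" for b
    proof -
      have "\<alpha> b \<le> (\<Sum>b\<in>Basis. \<alpha> b)"
        using that by (intro member_le_sum) auto
      also have "\<dots> \<le> d" using \<alpha> by (simp add: multi_indices_def)
      finally show ?thesis .
    qed
    with \<alpha> show "\<alpha> \<in> Basis \<rightarrow>\<^sub>E {..d}"
      by (auto simp: multi_indices_def PiE_iff)
  qed
  show "finite ((Basis :: 'a set) \<rightarrow>\<^sub>E {..d})"
    by (intro finite_PiE) auto
qed

text \<open>Multi-indices are \<open>undefined\<close> off \<open>Basis\<close>, hence the
  restricted constant function. Its monomial is constantly 1, so its constraint compares total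
  masses.\<close>

lemma zero_multi_index:
  "(\<lambda>b\<in>Basis. 0) \<in> (multi_indices d :: ('a::euclidean_space \<Rightarrow> nat) set)"
  by (simp add: multi_indices_def)

lemma monomial_zero: "monomial (\<lambda>b\<in>Basis. 0) z = 1"
  by (simp add: monomial_def)

lemma continuous_on_monomial: "continuous_on S (monomial \<alpha>)"
  unfolding monomial_def by (intro continuous_intros)

lemma borel_measurable_monomial [measurable]: "monomial \<alpha> \<in> borel_measurable borel"
  by (intro borel_measurable_continuous_onI continuous_on_monomial)

section \<open>Measures carried by closed and finite sets\<close>

text \<open>Closedness makes \<open>- K\<close> a Borel set. On a nonmeasurable set
  \<open>emeasure\<close> is 0 by default, and its vanishing would carry no information.\<close>

lemma AE_finite_borel_measures_on:
  assumes "\<mu> \<in> finite_borel_measures_on K" and "closed K"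
  shows "AE z in \<mu>. z \<in> K"
proof (rule AE_I)
  show "{z \<in> space \<mu>. z \<notin> K} \<subseteq> - K" by auto
  show "emeasure \<mu> (- K) = 0" "- K \<in> sets \<mu>"
    using assms by (auto simp: finite_borel_measures_on_def)
qed

text \<open>Almost everywhere the integrand coincides with a finite combination of indicators of the
  points of \<open>K\<close>, so a measure on \<open>K\<close> enters the program only through its
  point masses.\<close>

lemma integral_finite_support:
  fixes f :: "'a::euclidean_space \<Rightarrow> real"
  assumes K: "finite K" and \<nu>: "\<nu> \<in> finite_borel_measures_on K"
    and [measurable]: "f \<in> borel_measurable borel"
  shows "(LINT z|\<nu>. f z) = (\<Sum>k\<in>K. measure \<nu> {k} * f k)"
proof -
  have [measurable_cong]: "sets \<nu> = sets borel"
    using \<nu> by (simp add: finite_borel_measures_on_def)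
  interpret finite_measure \<nu>
    using \<nu> by (simp add: finite_borel_measures_on_def)
  have "AE z in \<nu>. f z = (\<Sum>k\<in>K. indicat_real {k} z * f k)"
    using AE_finite_borel_measures_on[OF \<nu> finite_imp_closed[OF K]]
  proof eventually_elim
    case (elim z)
    have "(\<Sum>k\<in>K. indicat_real {k} z * f k) = (\<Sum>k\<in>K. if k = z then f k else 0)"
      by (intro sum.cong) auto
    with K elim show ?case by simp
  qed
  then have "(LINT z|\<nu>. f z) = (LINT z|\<nu>. (\<Sum>k\<in>K. indicat_real {k} z * f k))"
    by (intro integral_cong_AE) auto
  also have "\<dots> = (\<Sum>k\<in>K. LINT z|\<nu>. indicat_real {k} z * f k)"
    by (intro Bochner_Integration.integral_sum integrable_mult_left)
      (auto simp: emeasure_eq_measure)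
  also have "\<dots> = (\<Sum>k\<in>K. measure \<nu> {k} * f k)"
    by (simp add: sets_eq_imp_space_eq[OF \<open>sets \<nu> = sets borel\<close>])
  finally show ?thesis .
qed

text \<open>The converse passage from weights to measures. \<open>point_measure\<close> lives on the
  subsets of \<open>K\<close>, so it is pushed forward along the identity to the Borel sets of the
  whole space.\<close>

lemma weights_measure:
  fixes K :: "'a::euclidean_space set"
  assumes K: "finite K" and w: "\<And>k. k \<in> K \<Longrightarrow> 0 \<le> w k"
  obtains \<nu> where "\<nu> \<in> finite_borel_measures_on K"
    and "\<And>f :: 'a \<Rightarrow> real. f \<in> borel_measurable borel \<Longrightarrow>
           (LINT z|\<nu>. f z) = (\<Sum>k\<in>K. w k * f k)"
proof
  define P where "P = point_measure K (\<lambda>k. ennreal (w k))"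
  have [measurable]: "(\<lambda>k. k) \<in> P \<rightarrow>\<^sub>M borel"
    by (simp add: P_def measurable_def space_point_measure sets_point_measure)
  have "finite_measure P"
    using K by (intro finite_measureI) (simp add: P_def space_point_measure emeasure_point_measure_finite)
  moreover have "emeasure (distr P borel (\<lambda>k. k)) (- K) = 0"
    using K by (subst emeasure_distr) (auto simp: P_def space_point_measure finite_imp_closed)
  ultimately show "distr P borel (\<lambda>k. k) \<in> finite_borel_measures_on K"
    by (simp add: finite_borel_measures_on_def finite_measure.finite_measure_distr)
  show "(LINT z|distr P borel (\<lambda>k. k). f z) = (\<Sum>k\<in>K. w k * f k)"
    if "f \<in> borel_measurable borel" for f :: "'a \<Rightarrow> real"
    using that K w by (simp add: integral_distr P_def[symmetric])
      (simp add: P_def lebesgue_integral_point_measure_finite)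
qed

section \<open>Attainment of the minimum of the linear program\<close>

lemma lp_feasible_nonneg:
  assumes "lp_feasible y d K (\<nu>, l)"
  shows "0 \<le> l"
  using assms zero_multi_index[of d] unfolding lp_feasible_def
  by (force intro: order_trans[OF abs_ge_zero])

lemma lp_value_attained:
  fixes K :: "'a::euclidean_space set"
  assumes K: "finite K"
  shows "\<exists>\<nu>. is_arg_min snd (lp_feasible y d K) (\<nu>, lp_value y d K)"
proof -
  let ?A = "multi_indices d :: ('a \<Rightarrow> nat) set"
  \<comment> \<open>The zero measure is feasible with value \<open>L\<close>, so only values up to
    \<open>L\<close> compete for the minimum.\<close>
  define L where "L = (\<Sum>\<alpha>\<in>?A. \<bar>y \<alpha>\<bar>)"
  have yL: "\<bar>y \<alpha>\<bar> \<le> L" if "\<alpha> \<in> ?A" for \<alpha>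
    unfolding L_def using that finite_multi_indices by (intro member_le_sum) auto
  have L0: "0 \<le> L" by (simp add: L_def sum_nonneg)
  \<comment> \<open>Weights are functions on the whole type, pinned to 0 off \<open>K\<close>: this
    makes \<open>C\<close> a product of compact sets, compact by Tychonoff. The bound
    \<open>2 * L\<close> comes from the constraint of index zero.\<close>
  define C where "C = (\<Pi>\<^sub>E k\<in>UNIV. if k \<in> K then {0..2 * L} else {0 :: real})"
  define D where "D = (\<Inter>\<alpha>\<in>?A. {p :: ('a \<Rightarrow> real) \<times> real.
    \<bar>y \<alpha> - (\<Sum>k\<in>K. fst p k * monomial \<alpha> k)\<bar> \<le> snd p})"
  have "compact C"
    unfolding C_def compactin_euclidean_iff[symmetric] euclidean_product_topology[symmetric]
    by (subst compactin_PiE) (auto simp: compactin_euclidean_iff)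
  moreover have "closed D"
  proof -
    have "continuous_on UNIV (\<lambda>p :: ('a \<Rightarrow> real) \<times> real. fst p k)" for k
      by (rule continuous_on_product_then_coordinatewise[OF continuous_on_fst[OF continuous_on_id]])
    then show ?thesis
      unfolding D_def by (intro closed_INT ballI closed_Collect_le continuous_intros)
  qed
  ultimately have "compact ((C \<times> {0..L}) \<inter> D)"
    by (intro compact_Int_closed compact_Times) auto
  moreover have "((\<lambda>_. 0), L) \<in> (C \<times> {0..L}) \<inter> D"
    using yL L0 by (auto simp: C_def D_def)
  ultimately have "\<exists>p\<in>(C \<times> {0..L}) \<inter> D. \<forall>q\<in>(C \<times> {0..L}) \<inter> D. snd p \<le> snd q"
    by (intro continuous_attains_inf continuous_on_snd continuous_on_id) blast+
  then obtain p where p: "p \<in> (C \<times> {0..L}) \<inter> D"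
    and p_min: "\<And>q. q \<in> (C \<times> {0..L}) \<inter> D \<Longrightarrow> snd p \<le> snd q"
    by blast
  have "0 \<le> fst p k" if "k \<in> K" for k
  proof -
    have "fst p \<in> C" using p by auto
    with that show ?thesis by (auto simp: C_def PiE_iff dest: spec[of _ k])
  qed
  then obtain \<nu> where \<nu>: "\<nu> \<in> finite_borel_measures_on K"
    and int: "\<And>f :: 'a \<Rightarrow> real. f \<in> borel_measurable borel \<Longrightarrow>
           (LINT z|\<nu>. f z) = (\<Sum>k\<in>K. fst p k * f k)"
    using weights_measure[OF K, of "fst p"] by blast
  have feas: "lp_feasible y d K (\<nu>, snd p)"
    using p \<nu> by (auto simp: lp_feasible_def int D_def)
  have min: "snd p \<le> l" if l: "lp_feasible y d K (\<nu>', l)" for \<nu>' l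
  proof (cases "l \<le> L")
    case True
    have \<nu>': "\<nu>' \<in> finite_borel_measures_on K"
      using l by (simp add: lp_feasible_def)
    have l': "\<bar>y \<alpha> - (\<Sum>k\<in>K. measure \<nu>' {k} * monomial \<alpha> k)\<bar> \<le> l" if "\<alpha> \<in> ?A" for \<alpha>
      using l that by (simp add: lp_feasible_def integral_finite_support[OF K \<nu>'])
    define w where "w k = (if k \<in> K then measure \<nu>' {k} else 0)" for k
    \<comment> \<open>The total weight differs from the moment of index zero by at most
      \<open>l\<close>, and both \<open>l\<close> and that moment are at most \<open>L\<close> in
      absolute value.\<close>
    have "(\<Sum>k\<in>K. measure \<nu>' {k}) \<le> 2 * L"
      using l'[OF zero_multi_index] yL[OF zero_multi_index] True by (simp add: monomial_zero)
    then have "measure \<nu>' {k} \<le> 2 * L" if "k \<in> K" for k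
      using member_le_sum[OF that, of "\<lambda>k. measure \<nu>' {k}"] K by simp
    then have "w \<in> C" by (auto simp: C_def w_def)
    moreover have "(w, l) \<in> D"
      using l' by (auto simp: D_def w_def)
    ultimately have "(w, l) \<in> (C \<times> {0..L}) \<inter> D"
      using True lp_feasible_nonneg[OF l] by auto
    from p_min[OF this] show ?thesis by simp
  \<comment> \<open>For \<open>l > L\<close> nothing remains to compare, since
    \<open>snd p \<le> L\<close>.\<close>
  qed (use p in auto)
  have "lp_value y d K = snd p"
    unfolding lp_value_def using feas min by (intro Least_equality) auto
  with feas min have "is_arg_min snd (lp_feasible y d K) (\<nu>, lp_value y d K)"
    by (force simp: is_arg_min_def)
  then show ?thesis ..
qed

text \<open>Over the reals, \<open>LEAST\<close> is a lower bound here because the minimum is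
  attained.\<close>

lemma lp_value_le:
  assumes "finite K" and "lp_feasible y d K (\<nu>, l)"
  shows "lp_value y d K \<le> l"
  using lp_value_attained[OF assms(1), of y d] assms(2) by (force simp: is_arg_min_def not_less)

lemma lp_value_nonneg:
  assumes "finite K"
  shows "0 \<le> lp_value y d K"
  using lp_value_attained[OF assms, of y d] lp_feasible_nonneg by (auto simp: is_arg_min_def)

section \<open>Spreading a measure over a mesh\<close>

text \<open>The measure \<nu> is chosen before \<open>f\<close> and \<delta>, because a single
  measure has to satisfy the constraints of all multi-indices at once. Its weight at
  \<open>k\<close> is the \<mu>-integral of the partition function at \<open>k\<close>.\<close>

lemma mesh_approximation:
  fixes Z :: "'a::euclidean_space set"
  assumes mesh: "is_mesh Z \<epsilon> K" and \<epsilon>: "0 < \<epsilon>"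
    and \<mu>: "\<mu> \<in> finite_borel_measures_on Z" and Z: "compact Z"
  shows "\<exists>\<nu>\<in>finite_borel_measures_on K. \<forall>f \<delta>. continuous_on UNIV f \<longrightarrow>
           (\<forall>z\<in>Z. \<forall>k\<in>K. dist z k < 2 * \<epsilon> \<longrightarrow> \<bar>f z - f k\<bar> \<le> \<delta>) \<longrightarrow>
           \<bar>(LINT z|\<mu>. f z) - (LINT z|\<nu>. f z)\<bar> \<le> \<delta> * measure \<mu> UNIV"
proof -
  have K: "finite K" and near: "\<And>z. z \<in> Z \<Longrightarrow> \<exists>k\<in>K. dist z k \<le> \<epsilon>"
    using mesh by (auto simp: is_mesh_def dist_norm norm_minus_commute)
  have sets [measurable_cong]: "sets \<mu> = sets borel"
    using \<mu> by (simp add: finite_borel_measures_on_def)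
  have space: "space \<mu> = UNIV"
    using sets_eq_imp_space_eq[OF sets] by simp
  interpret finite_measure \<mu>
    using \<mu> by (simp add: finite_borel_measures_on_def)
  have AE_Z: "AE z in \<mu>. z \<in> Z"
    using AE_finite_borel_measures_on[OF \<mu> compact_imp_closed[OF Z]] .
  \<comment> \<open>A tent of radius \<open>2 * \<epsilon>\<close> has height at least \<epsilon> at
    distance \<epsilon> from its centre. Hence at each point of \<open>Z\<close> some tent is
    positive, even if the nearest mesh point is at distance exactly \<epsilon>.\<close>
  define h where "h k z = max 0 (2 * \<epsilon> - dist z k)" for k z :: 'a
  define s where "s z = (\<Sum>k\<in>K. h k z)" for z
  \<comment> \<open>Off \<open>Z\<close> the denominator may vanish; division by zero then gives 0,
    so the values stay in [0, 1] everywhere.\<close>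
  define \<phi> where "\<phi> k z = h k z / s z" for k z
  have h0: "0 \<le> h k z" for k z by (simp add: h_def)
  have s0: "0 \<le> s z" for z by (simp add: s_def h0 sum_nonneg)
  have \<phi>0: "0 \<le> \<phi> k z" for k z by (simp add: \<phi>_def h0 s0)
  have \<phi>1: "\<phi> k z \<le> 1" if "k \<in> K" for k z
  proof -
    have "h k z \<le> s z" unfolding s_def using that K h0 by (intro member_le_sum) auto
    then show ?thesis using s0[of z] by (cases "s z = 0") (auto simp: \<phi>_def divide_le_eq_1)
  qed
  have \<phi>_sum: "(\<Sum>k\<in>K. \<phi> k z) = 1" if "z \<in> Z" for z
  proof -
    obtain k where k: "k \<in> K" "dist z k \<le> \<epsilon>" using near[OF \<open>z \<in> Z\<close>] by blast
    then have "0 < h k z" using \<epsilon> by (simp add: h_def)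
    also have "h k z \<le> s z" unfolding s_def using k K h0 by (intro member_le_sum) auto
    finally have "s z \<noteq> 0" by simp
    then show ?thesis by (simp add: \<phi>_def s_def[symmetric] sum_divide_distrib[symmetric])
  qed
  have [measurable]: "h k \<in> borel_measurable borel" for k
    unfolding h_def by measurable
  have [measurable]: "\<phi> k \<in> borel_measurable borel" for k
    unfolding \<phi>_def s_def by measurable
  have \<phi>_int: "integrable \<mu> (\<phi> k)" if "k \<in> K" for k
    using \<phi>0 \<phi>1[OF that] by (intro integrable_const_bound[where B = 1]) auto
  obtain \<nu> where \<nu>: "\<nu> \<in> finite_borel_measures_on K"
    and int: "\<And>f :: 'a \<Rightarrow> real. f \<in> borel_measurable borel \<Longrightarrow>
           (LINT z|\<nu>. f z) = (\<Sum>k\<in>K. (LINT z|\<mu>. \<phi> k z) * f k)"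
    using weights_measure[OF K, of "\<lambda>k. LINT z|\<mu>. \<phi> k z"] by (auto simp: \<phi>0)
  show ?thesis
  proof (intro bexI[OF _ \<nu>] allI impI)
    fix f :: "'a \<Rightarrow> real" and \<delta> :: real
    assume f: "continuous_on UNIV f"
      and osc: "\<forall>z\<in>Z. \<forall>k\<in>K. dist z k < 2 * \<epsilon> \<longrightarrow> \<bar>f z - f k\<bar> \<le> \<delta>"
    have [measurable]: "f \<in> borel_measurable borel"
      using f by (rule borel_measurable_continuous_onI)
    have "bounded (f ` Z)"
      using Z f by (intro compact_imp_bounded compact_continuous_image) (auto intro: continuous_on_subset)
    then obtain B where "\<And>z. z \<in> Z \<Longrightarrow> \<bar>f z\<bar> \<le> B"
      by (auto simp: bounded_iff)
    then have f_int: "integrable \<mu> f"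
      using AE_Z by (intro integrable_const_bound[where B = B]) auto
    have sum_int: "integrable \<mu> (\<lambda>z. \<Sum>k\<in>K. \<phi> k z * f k)"
      using \<phi>_int by auto
    \<comment> \<open>By linearity the integral of \<open>f\<close> against \<nu> is a
      \<mu>-integral of a weighted average of the values \<open>f k\<close>.\<close>
    have "(LINT z|\<mu>. f z) - (LINT z|\<nu>. f z) = (LINT z|\<mu>. f z - (\<Sum>k\<in>K. \<phi> k z * f k))"
      using f_int sum_int \<phi>_int by (simp add: int)
    also have "\<bar>\<dots>\<bar> \<le> (LINT z|\<mu>. \<bar>f z - (\<Sum>k\<in>K. \<phi> k z * f k)\<bar>)"
      by (rule integral_abs_bound)
    also have "\<dots> \<le> (LINT z|\<mu>. \<delta>)"
    proof (rule integral_mono_AE)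
      show "AE z in \<mu>. \<bar>f z - (\<Sum>k\<in>K. \<phi> k z * f k)\<bar> \<le> \<delta>"
        using AE_Z
      proof eventually_elim
        case (elim z)
        \<comment> \<open>Since the weights sum to 1 on \<open>Z\<close>, the error is an average of
          differences \<open>f z - f k\<close>. Only mesh points closer than
          \<open>2 * \<epsilon>\<close> contribute, as the other weights are 0.\<close>
        have "f z - (\<Sum>k\<in>K. \<phi> k z * f k) = (\<Sum>k\<in>K. \<phi> k z) * f z - (\<Sum>k\<in>K. \<phi> k z * f k)"
          using \<phi>_sum[OF elim] by simp
        also have "\<dots> = (\<Sum>k\<in>K. \<phi> k z * (f z - f k))"
          by (simp add: sum_distrib_right sum_subtractf right_diff_distrib)
        also have "\<bar>\<dots>\<bar> \<le> (\<Sum>k\<in>K. \<bar>\<phi> k z * (f z - f k)\<bar>)"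
          by (rule sum_abs)
        also have "\<dots> \<le> (\<Sum>k\<in>K. \<phi> k z * \<delta>)"
        proof (rule sum_mono)
          fix k assume k: "k \<in> K"
          show "\<bar>\<phi> k z * (f z - f k)\<bar> \<le> \<phi> k z * \<delta>"
          proof (cases "dist z k < 2 * \<epsilon>")
            case True
            then show ?thesis
              using osc elim k \<phi>0[of k z] by (simp add: abs_mult mult_left_mono)
          next
            case False
            then show ?thesis by (simp add: \<phi>_def h_def)
          qed
        qed
        also have "\<dots> = \<delta>"
          using \<phi>_sum[OF elim] by (simp add: sum_distrib_right[symmetric])
        finally show ?case .
      qed
    qed (use f_int sum_int in auto)
    also have "\<dots> = \<delta> * measure \<mu> UNIV"
      by (simp add: space)
    finally show "\<bar>(LINT z|\<mu>. f z) - (LINT z|\<nu>. f z)\<bar> \<le> \<delta> * measure \<mu> UNIV" .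
  qed
qed

section \<open>Convergence as the mesh is refined\<close>

lemma lp_value_tendsto_zero:
  fixes Z :: "'a::euclidean_space set"
  assumes Z: "compact Z" and \<mu>: "\<mu> \<in> finite_borel_measures_on Z"
    and y: "\<And>\<alpha>. \<alpha> \<in> multi_indices d \<Longrightarrow> y \<alpha> = (LINT z|\<mu>. monomial \<alpha> z)"
    and mesh: "\<And>\<epsilon>. 0 < \<epsilon> \<Longrightarrow> is_mesh Z \<epsilon> (mesh \<epsilon>)"
  shows "((\<lambda>\<epsilon>. lp_value y d (mesh \<epsilon>)) \<longlongrightarrow> 0) (at_right 0)"
proof (rule tendstoI)
  fix e :: real
  assume e: "0 < e"
  \<comment> \<open>The summand 1 keeps the denominator positive when \<mu> is zero and makes the
    resulting error strictly less than \<open>e\<close>.\<close>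
  define \<delta> where "\<delta> = e / (2 * (measure \<mu> UNIV + 1))"
  have \<delta>: "0 < \<delta>" using e by (simp add: \<delta>_def add_nonneg_pos)
  have \<delta>e: "\<delta> * measure \<mu> UNIV < e"
  proof -
    have "\<delta> * measure \<mu> UNIV < \<delta> * (2 * (measure \<mu> UNIV + 1))"
      using \<delta> by (intro mult_strict_left_mono) (auto intro: add_nonneg_pos)
    also have "\<dots> = e"
      by (simp add: \<delta>_def add_nonneg_eq_0_iff)
    finally show ?thesis .
  qed
  have "\<forall>\<^sub>F \<epsilon> in at_right 0. \<forall>\<alpha>\<in>multi_indices d. \<forall>z\<in>Z. \<forall>k\<in>Z.
          dist z k < 2 * \<epsilon> \<longrightarrow> \<bar>monomial \<alpha> z - monomial \<alpha> k\<bar> \<le> \<delta>"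
  \<comment> \<open>There are finitely many multi-indices, so one threshold for \<epsilon> serves
    them all.\<close>
  proof (rule eventually_ball_finite[OF finite_multi_indices], rule ballI)
    fix \<alpha> :: "'a \<Rightarrow> nat"
    have "uniformly_continuous_on Z (monomial \<alpha>)"
      using Z by (intro compact_uniformly_continuous continuous_on_monomial)
    then obtain \<eta> where \<eta>: "0 < \<eta>"
      "\<And>z k. \<lbrakk>z \<in> Z; k \<in> Z; dist z k < \<eta>\<rbrakk> \<Longrightarrow> dist (monomial \<alpha> z) (monomial \<alpha> k) < \<delta>"
      using \<delta> unfolding uniformly_continuous_on_def by metis
    \<comment> \<open>Half of \<eta>, because the tents reach up to
      \<open>2 * \<epsilon>\<close>.\<close>
    have "\<forall>\<^sub>F \<epsilon> in at_right 0. \<epsilon> < \<eta> / 2"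
      using \<eta>(1) by (intro eventually_at_rightI[of 0 "\<eta> / 2"]) auto
    then show "\<forall>\<^sub>F \<epsilon> in at_right 0. \<forall>z\<in>Z. \<forall>k\<in>Z.
          dist z k < 2 * \<epsilon> \<longrightarrow> \<bar>monomial \<alpha> z - monomial \<alpha> k\<bar> \<le> \<delta>"
      by eventually_elim (use \<eta>(2) in \<open>force simp: dist_real_def\<close>)
  qed
  then show "\<forall>\<^sub>F \<epsilon> in at_right 0. dist (lp_value y d (mesh \<epsilon>)) 0 < e"
    using eventually_at_right_less[of 0]
  proof eventually_elim
    case (elim \<epsilon>)
    let ?K = "mesh \<epsilon>"
    have K: "finite ?K" "?K \<subseteq> Z"
      using mesh[OF elim(2)] by (auto simp: is_mesh_def)
    obtain \<nu> where \<nu>: "\<nu> \<in> finite_borel_measures_on ?K"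
      and approx: "\<forall>f \<delta>. continuous_on UNIV f \<longrightarrow>
           (\<forall>z\<in>Z. \<forall>k\<in>?K. dist z k < 2 * \<epsilon> \<longrightarrow> \<bar>f z - f k\<bar> \<le> \<delta>) \<longrightarrow>
           \<bar>(LINT z|\<mu>. f z) - (LINT z|\<nu>. f z)\<bar> \<le> \<delta> * measure \<mu> UNIV"
      using mesh_approximation[OF mesh[OF elim(2)] elim(2) \<mu> Z] by (elim bexE)
    have "\<bar>y \<alpha> - (LINT z|\<nu>. monomial \<alpha> z)\<bar> \<le> \<delta> * measure \<mu> UNIV" if "\<alpha> \<in> multi_indices d" for \<alpha>
      unfolding y[OF that]
      using elim(1) that K(2) by (intro approx[rule_format] continuous_on_monomial) auto
    then have "lp_feasible y d ?K (\<nu>, \<delta> * measure \<mu> UNIV)"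
      using \<nu> by (simp add: lp_feasible_def)
    then have "lp_value y d ?K \<le> \<delta> * measure \<mu> UNIV"
      by (rule lp_value_le[OF K(1)])
    with lp_value_nonneg[OF K(1), of y d] \<delta>e show ?case
      by (simp add: dist_real_def)
  qed
qed

theorem theorem3:
  fixes ti tf :: real
    and U :: "(real ^ 'm) set" and X :: "(real ^ 'n) set"
    and Z :: "(real \<times> (real ^ 'm) \<times> (real ^ 'n)) set"
    and r :: nat
    and \<mu> :: "(real \<times> (real ^ 'm) \<times> (real ^ 'n)) measure"
    and y :: "(real \<times> (real ^ 'm) \<times> (real ^ 'n) \<Rightarrow> nat) \<Rightarrow> real"
    and mesh :: "real \<Rightarrow> (real \<times> (real ^ 'm) \<times> (real ^ 'n)) set"
  assumes "ti \<le> tf" and "compact U" and "compact X"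
    and "Z \<subseteq> {ti..tf} \<times> U \<times> X" and "compact Z"
    and "\<mu> \<in> finite_borel_measures_on Z"
    and "\<And>\<alpha>. \<alpha> \<in> multi_indices (2 * r) \<Longrightarrow> y \<alpha> = (LINT z:Z|\<mu>. monomial \<alpha> z)"
    and "\<And>\<epsilon>. \<epsilon> > 0 \<Longrightarrow> is_mesh Z \<epsilon> (mesh \<epsilon>)"
  shows "(\<forall>\<epsilon>>0. \<exists>\<nu>. is_arg_min snd (lp_feasible y (2 * r) (mesh \<epsilon>))
                       (\<nu>, lp_value y (2 * r) (mesh \<epsilon>)))
    \<and> ((\<lambda>\<epsilon>. lp_value y (2 * r) (mesh \<epsilon>)) \<longlongrightarrow> 0) (at_right 0)
    \<and> (\<forall>\<nu>. (\<forall>\<epsilon>>0. is_arg_min snd (lp_feasible y (2 * r) (mesh \<epsilon>))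
                       (\<nu> \<epsilon>, lp_value y (2 * r) (mesh \<epsilon>))) \<longrightarrow>
         (\<forall>\<alpha>\<in>multi_indices (2 * r).
            ((\<lambda>\<epsilon>. LINT z|\<nu> \<epsilon>. monomial \<alpha> z) \<longlongrightarrow> y \<alpha>) (at_right 0)))"
proof (intro conjI allI impI ballI)
  have fin: "finite (mesh \<epsilon>)" if "0 < \<epsilon>" for \<epsilon>
    using assms(8)[OF that] by (simp add: is_mesh_def)
  then show "\<exists>\<nu>. is_arg_min snd (lp_feasible y (2 * r) (mesh \<epsilon>)) (\<nu>, lp_value y (2 * r) (mesh \<epsilon>))"
    if "0 < \<epsilon>" for \<epsilon>
    using that by (intro lp_value_attained)
  have sets [measurable_cong]: "sets \<mu> = sets borel"
    using assms(6) by (simp add: finite_borel_measures_on_def)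
  have Z: "closed Z" using assms(5) by (rule compact_imp_closed)
  \<comment> \<open>As \<mu> vanishes off \<open>Z\<close>, integrals over \<open>Z\<close> become
    integrals over the whole space, the form used for \<nu> in the program.\<close>
  have "(LINT z:Z|\<mu>. monomial \<alpha> z) = (LINT z|\<mu>. monomial \<alpha> z)" for \<alpha>
    unfolding set_lebesgue_integral_def
  proof (rule integral_cong_AE)
    show "AE z in \<mu>. indicat_real Z z *\<^sub>R monomial \<alpha> z = monomial \<alpha> z"
      using AE_finite_borel_measures_on[OF assms(6) Z] by eventually_elim simp
  qed (auto intro!: borel_measurable_scaleR borel_measurable_indicator simp: sets Z
      cong: measurable_cong_sets)
  with assms(7) have "y \<alpha> = (LINT z|\<mu>. monomial \<alpha> z)" if "\<alpha> \<in> multi_indices (2 * r)" for \<alpha>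
    using that by simp
  then show lim: "((\<lambda>\<epsilon>. lp_value y (2 * r) (mesh \<epsilon>)) \<longlongrightarrow> 0) (at_right 0)"
    by (rule lp_value_tendsto_zero[OF assms(5,6) _ assms(8)])
  fix \<nu> and \<alpha> :: "real \<times> (real ^ 'm) \<times> (real ^ 'n) \<Rightarrow> nat"
  assume \<nu>: "\<forall>\<epsilon>>0. is_arg_min snd (lp_feasible y (2 * r) (mesh \<epsilon>))
                       (\<nu> \<epsilon>, lp_value y (2 * r) (mesh \<epsilon>))"
    and \<alpha>: "\<alpha> \<in> multi_indices (2 * r)"
  \<comment> \<open>A minimiser is feasible with the optimal value, which therefore bounds each of
    its moment errors; the limit follows by comparison.\<close>
  have "\<forall>\<^sub>F \<epsilon> in at_right 0.
      norm ((LINT z|\<nu> \<epsilon>. monomial \<alpha> z) - y \<alpha>) \<le> lp_value y (2 * r) (mesh \<epsilon>)"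
    using eventually_at_right_less[of 0]
  proof eventually_elim
    case (elim \<epsilon>)
    then have "lp_feasible y (2 * r) (mesh \<epsilon>) (\<nu> \<epsilon>, lp_value y (2 * r) (mesh \<epsilon>))"
      using \<nu> by (simp add: is_arg_min_def)
    with \<alpha> show ?case by (simp add: lp_feasible_def abs_minus_commute)
  qed
  from Lim_null_comparison[OF this lim]
  show "((\<lambda>\<epsilon>. LINT z|\<nu> \<epsilon>. monomial \<alpha> z) \<longlongrightarrow> y \<alpha>) (at_right 0)"
    by (simp add: LIM_zero_iff)
qed

end
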